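(* Let $n\ge 1$ and let $V_{I_2(2n+1)}$, with basis $v_0,\dots,v_{2n}$ and operators $X_0,X_1,E_0,E_1$, be as in the context. For $0\le i\le 2n$ define the operator $p_i=[\ldots X_0X_1]_i\,E_0\,[X_1^{-1}X_0^{-1}\ldots]_i$ on $V_{I_2(2n+1)}$. Then for all $0\le i,j\le 2n$: $$p_i(v_j)=\begin{cases}\tau v_i,& i=j;\\ v_i,& i-j\equiv 0 \bmod 2,\ j\ne i;\\ l\,v_i,& i>j,\ i-j\equiv 1\bmod 2;\\ l^{-1}v_i,& i<j,\ i-j\equiv 1\bmod 2.\end{cases}$$
   Context: Notation: $F_\Lambda=\mathbb{Q}(m,l)$ with independent variables $m,l$ and $\tau=\frac{l-l^{-1}}{m}+1$. $[AB\ldots]_N$ is the alternating word of length $N$ in $A,B$ beginning with $A$; $[\ldots AB]_N$ is the alternating word of length $N$ ending with $B$ (so the last two letters are $AB$); words of length $0$ are the identity. $V_{I_2(2n+1)}$ is the $F_\Lambda$-vector space with basis $v_0,\dots,v_{2n}$ and operators: $X_0v_0=lv_0$; $X_0v_{2k}=mv_0-mv_{2k}+v_{2k-1}$ for $1\le k\le n$; $X_0v_{2k+1}=v_{2k+2}$ for $0\le k\le n-1$. $X_1v_{2k}=v_{2k+1}$ for $0\le k\le n-1$; $X_1v_{2n}=lv_{2n}$; $X_1v_{2k+1}=v_{2k}-mv_{2k+1}+ml\,v_{2n}$ for $0\le k\le n-1$. $X_0^{-1},X_1^{-1}$ are the inverse operators: $X_0^{-1}v_0=l^{-1}v_0$,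 $X_0^{-1}v_{2k}=v_{2k-1}$ ($1\le k\le n$), $X_0^{-1}v_{2k+1}=-ml^{-1}v_0+mv_{2k+1}+v_{2k+2}$; $X_1^{-1}v_{2k}=mv_{2k}+v_{2k+1}-mv_{2n}$ ($0\le k\le n-1$), $X_1^{-1}v_{2n}=l^{-1}v_{2n}$, $X_1^{-1}v_{2k+1}=v_{2k}$. $E_0v_0=\tau v_0$; $E_0v_{2k}=v_0$ for $1\le k\le n$; $E_0v_{2k+1}=l^{-1}v_0$ for $0\le k\le n-1$. $E_1v_{2k}=v_{2n}$ for $0\le k\le n-1$; $E_1v_{2n}=\tau v_{2n}$; $E_1v_{2k+1}=l\,v_{2n}$ for $0\le k\le n-1$. *)

theory Defs
  imports "Jordan_Normal_Form.Matrix" "HOL-Computational_Algebra.Fraction_Field"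
    "HOL-Computational_Algebra.Polynomial" "HOL-Number_Theory.Cong"
begin

text \<open>The field of rational functions over the rationals in two independent variables,
  as the fraction field of \<open>\<rat>[m][l]\<close>.\<close>

type_synonym ratfun = "rat poly poly fract"

definition var_m :: ratfun where
  "var_m = Fract [:[:0, 1:]:] 1"

definition var_l :: ratfun where
  "var_l = Fract [:0, 1:] 1"

definition tau :: ratfun where
  "tau = (var_l - inverse var_l) / var_m + 1"

text \<open>\<open>V\<close> is \<open>carrier_vec (2 * n + 1)\<close> with its standard basis.\<close>

type_synonym operator = "ratfun vec \<Rightarrow> ratfun vec"

definition bv :: "nat \<Rightarrow> nat \<Rightarrow> ratfun vec" where
  "bv n j = unit_vec (2 * n + 1) j"

text \<open>The linear operator on \<open>V\<close> sending the \<open>j\<close>-th basis vector to \<open>f j\<close>. Vectors outside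
  the carrier are irrelevant.\<close>

definition lin_op :: "nat \<Rightarrow> (nat \<Rightarrow> ratfun vec) \<Rightarrow> operator" where
  "lin_op n f = (\<lambda>x. vec (2 * n + 1) (\<lambda>i. \<Sum>j<2 * n + 1. x $ j * f j $ i))"

definition X0 :: "nat \<Rightarrow> operator" where
  "X0 n = lin_op n (\<lambda>j.
     if j = 0 then var_l \<cdot>\<^sub>v bv n 0
     else if even j then var_m \<cdot>\<^sub>v bv n 0 - var_m \<cdot>\<^sub>v bv n j + bv n (j - 1)
     else bv n (j + 1))"

definition X1 :: "nat \<Rightarrow> operator" where
  "X1 n = lin_op n (\<lambda>j.
     if j = 2 * n then var_l \<cdot>\<^sub>v bv n (2 * n)
     else if even j then bv n (j + 1)
     else bv n (j - 1) - var_m \<cdot>\<^sub>v bv n j + (var_m * var_l) \<cdot>\<^sub>v bv n (2 * n))"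

definition X0_inv :: "nat \<Rightarrow> operator" where
  "X0_inv n = lin_op n (\<lambda>j.
     if j = 0 then inverse var_l \<cdot>\<^sub>v bv n 0
     else if even j then bv n (j - 1)
     else (- var_m * inverse var_l) \<cdot>\<^sub>v bv n 0 + var_m \<cdot>\<^sub>v bv n j + bv n (j + 1))"

definition X1_inv :: "nat \<Rightarrow> operator" where
  "X1_inv n = lin_op n (\<lambda>j.
     if j = 2 * n then inverse var_l \<cdot>\<^sub>v bv n (2 * n)
     else if even j then var_m \<cdot>\<^sub>v bv n j + bv n (j + 1) - var_m \<cdot>\<^sub>v bv n (2 * n)
     else bv n (j - 1))"

definition E0 :: "nat \<Rightarrow> operator" where
  "E0 n = lin_op n (\<lambda>j.
     if j = 0 then tau \<cdot>\<^sub>v bv n 0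
     else if even j then bv n 0
     else inverse var_l \<cdot>\<^sub>v bv n 0)"

definition E1 :: "nat \<Rightarrow> operator" where
  "E1 n = lin_op n (\<lambda>j.
     if j = 2 * n then tau \<cdot>\<^sub>v bv n (2 * n)
     else if even j then bv n (2 * n)
     else var_l \<cdot>\<^sub>v bv n (2 * n))"

text \<open>\<open>alt_from N A B\<close> is the alternating word \<open>[AB\<dots>]\<close> of length \<open>N\<close> beginning with \<open>A\<close>;
  \<open>alt_to N A B\<close> is the alternating word \<open>[\<dots>AB]\<close> of length \<open>N\<close> ending with \<open>B\<close>.\<close>

fun alt_from :: "nat \<Rightarrow> operator \<Rightarrow> operator \<Rightarrow> operator" where
  "alt_from 0 A B = id"
| "alt_from (Suc N) A B = A \<circ> alt_from N B A"

fun alt_to :: "nat \<Rightarrow> operator \<Rightarrow> operator \<Rightarrow> operator" where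
  "alt_to 0 A B = id"
| "alt_to (Suc N) A B = alt_to N B A \<circ> B"

definition p_op :: "nat \<Rightarrow> nat \<Rightarrow> operator" where
  "p_op n i = alt_to i (X0 n) (X1 n) \<circ> E0 n \<circ> alt_from i (X1_inv n) (X0_inv n)"

lemma lin_op_carrier: "lin_op n f x \<in> carrier_vec (2 * n + 1)"
  by (simp add: lin_op_def)

lemma lin_op_bv:
  assumes "j \<le> 2 * n" "f j \<in> carrier_vec (2 * n + 1)"
  shows "lin_op n f (bv n j) = f j"
proof -
  have "(\<Sum>k<2 * n + 1. bv n j $ k * f k $ i) = f j $ i" for i
  proof -
    have "(\<Sum>k<2 * n + 1. bv n j $ k * f k $ i) = (\<Sum>k<2 * n + 1. if k = j then f k $ i else 0)"
      by (rule sum.cong) (use assms in \<open>auto simp: bv_def\<close>)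
    then show ?thesis using assms by simp
  qed
  then show ?thesis using assms by (auto simp: lin_op_def)
qed

lemma lin_op_add:
  assumes "x \<in> carrier_vec (2 * n + 1)" "y \<in> carrier_vec (2 * n + 1)"
  shows "lin_op n f (x + y) = lin_op n f x + lin_op n f y"
  using assms by (auto simp: lin_op_def algebra_simps sum.distrib)

lemma lin_op_diff:
  assumes "x \<in> carrier_vec (2 * n + 1)" "y \<in> carrier_vec (2 * n + 1)"
  shows "lin_op n f (x - y) = lin_op n f x - lin_op n f y"
  using assms by (auto simp: lin_op_def algebra_simps sum_subtractf)

lemma lin_op_smult:
  assumes "x \<in> carrier_vec (2 * n + 1)"
  shows "lin_op n f (c \<cdot>\<^sub>v x) = c \<cdot>\<^sub>v lin_op n f x"
  using assms by (auto simp: lin_op_def sum_distrib_left algebra_simps)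

lemma bv_carrier [simp]: "bv n j \<in> carrier_vec (2 * n + 1)"
  by (simp add: bv_def)

lemma bv_carrier_Suc [simp]: "bv n j \<in> carrier_vec (Suc (2 * n))"
  by (simp add: bv_def)

lemma lin_op_inverseI:
  assumes "\<And>j. j \<le> 2 * n \<Longrightarrow> lin_op n f (g j) = bv n j"
    and "x \<in> carrier_vec (2 * n + 1)"
  shows "lin_op n f (lin_op n g x) = x"
proof (rule eq_vecI)
  fix i assume "i < dim_vec x"
  then have i: "i < 2 * n + 1" using assms by simp
  have d: "(\<Sum>k<2 * n + 1. g j $ k * f k $ i) = (if i = j then 1 else 0)" if "j \<le> 2 * n" for j
    using arg_cong[OF assms(1)[OF that], of "\<lambda>v. v $ i"] i that
    by (simp add: lin_op_def bv_def del: sum.lessThan_Suc)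
  have "lin_op n f (lin_op n g x) $ i
      = (\<Sum>k<2 * n + 1. \<Sum>j<2 * n + 1. x $ j * (g j $ k * f k $ i))"
    using i by (simp add: lin_op_def sum_distrib_right mult.assoc del: sum.lessThan_Suc)
  also have "\<dots> = (\<Sum>j<2 * n + 1. x $ j * (\<Sum>k<2 * n + 1. g j $ k * f k $ i))"
    by (subst sum.swap) (simp only: sum_distrib_left)
  also have "\<dots> = (\<Sum>j<2 * n + 1. if j = i then x $ j else 0)"
    by (rule sum.cong[OF refl], subst d) auto
  also have "\<dots> = x $ i" using i by simp
  finally show "lin_op n f (lin_op n g x) $ i = x $ i" .
qed (use assms in \<open>simp add: lin_op_def\<close>)

lemma var_nonzero [simp]: "var_m \<noteq> 0" "var_l \<noteq> 0"
  by (simp_all add: var_m_def var_l_def Zero_fract_def eq_fract)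

lemmas lin_op_simps = lin_op_add lin_op_diff lin_op_smult lin_op_bv

lemma X0_X0_inv:
  assumes "x \<in> carrier_vec (2 * n + 1)"
  shows "X0 n (X0_inv n x) = x"
  unfolding X0_def X0_inv_def
proof (rule lin_op_inverseI[OF _ assms])
  fix j assume "j \<le> 2 * n"
  moreover have "odd j \<Longrightarrow> j < 2 * n" using calculation by (cases "j = 2 * n") auto
  ultimately show "lin_op n (\<lambda>j.
     if j = 0 then var_l \<cdot>\<^sub>v bv n 0
     else if even j then var_m \<cdot>\<^sub>v bv n 0 - var_m \<cdot>\<^sub>v bv n j + bv n (j - 1)
     else bv n (j + 1)) (if j = 0 then inverse var_l \<cdot>\<^sub>v bv n 0
     else if even j then bv n (j - 1)
     else (- var_m * inverse var_l) \<cdot>\<^sub>v bv n 0 + var_m \<cdot>\<^sub>v bv n j + bv n (j + 1)) = bv n j"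
    by (auto simp: lin_op_simps) (auto simp: bv_def algebra_simps intro!: eq_vecI)
qed

lemma X0_inv_X0:
  assumes "x \<in> carrier_vec (2 * n + 1)"
  shows "X0_inv n (X0 n x) = x"
  unfolding X0_def X0_inv_def
proof (rule lin_op_inverseI[OF _ assms])
  fix j assume "j \<le> 2 * n"
  moreover have "odd j \<Longrightarrow> j < 2 * n" using calculation by (cases "j = 2 * n") auto
  ultimately show "lin_op n (\<lambda>j. if j = 0 then inverse var_l \<cdot>\<^sub>v bv n 0
     else if even j then bv n (j - 1)
     else (- var_m * inverse var_l) \<cdot>\<^sub>v bv n 0 + var_m \<cdot>\<^sub>v bv n j + bv n (j + 1)) (
     if j = 0 then var_l \<cdot>\<^sub>v bv n 0
     else if even j then var_m \<cdot>\<^sub>v bv n 0 - var_m \<cdot>\<^sub>v bv n j + bv n (j - 1)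
     else bv n (j + 1))  = bv n j"
    by (auto simp: lin_op_simps) (auto simp: bv_def algebra_simps intro!: eq_vecI)
qed

lemma X1_X1_inv:
  assumes "x \<in> carrier_vec (2 * n + 1)"
  shows "X1 n (X1_inv n x) = x"
  unfolding X1_def X1_inv_def
proof (rule lin_op_inverseI[OF _ assms])
  fix j assume "j \<le> 2 * n"
  moreover have "even j \<Longrightarrow> Suc j \<noteq> 2 * n" by (metis even_Suc even_mult_iff even_numeral)
  ultimately show "lin_op n (\<lambda>j.
     if j = 2 * n then var_l \<cdot>\<^sub>v bv n (2 * n)
     else if even j then bv n (j + 1)
     else bv n (j - 1) - var_m \<cdot>\<^sub>v bv n j + (var_m * var_l) \<cdot>\<^sub>v bv n (2 * n)) (
     if j = 2 * n then inverse var_l \<cdot>\<^sub>v bv n (2 * n)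
     else if even j then var_m \<cdot>\<^sub>v bv n j + bv n (j + 1) - var_m \<cdot>\<^sub>v bv n (2 * n)
     else bv n (j - 1)) = bv n j"
    by (auto simp: lin_op_simps) (auto simp: bv_def mult.commute algebra_simps intro!: eq_vecI)
qed

lemma X1_inv_X1:
  assumes "x \<in> carrier_vec (2 * n + 1)"
  shows "X1_inv n (X1 n x) = x"
  unfolding X1_def X1_inv_def
proof (rule lin_op_inverseI[OF _ assms])
  fix j assume "j \<le> 2 * n"
  moreover have "even j \<Longrightarrow> Suc j \<noteq> 2 * n" by (metis even_Suc even_mult_iff even_numeral)
  ultimately show "lin_op n (\<lambda>j. if j = 2 * n then inverse var_l \<cdot>\<^sub>v bv n (2 * n)
     else if even j then var_m \<cdot>\<^sub>v bv n j + bv n (j + 1) - var_m \<cdot>\<^sub>v bv n (2 * n)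
     else bv n (j - 1)) (
     if j = 2 * n then var_l \<cdot>\<^sub>v bv n (2 * n)
     else if even j then bv n (j + 1)
     else bv n (j - 1) - var_m \<cdot>\<^sub>v bv n j + (var_m * var_l) \<cdot>\<^sub>v bv n (2 * n)) = bv n j"
    by (auto simp: lin_op_simps) (auto simp: bv_def mult.commute algebra_simps intro!: eq_vecI)
qed

end

theory Submission
  imports Defs
begin

text \<open>
  Every \<open>p\<^sub>i\<close> has rank one. Lengthening both words by one letter conjugates the operator,
  \<open>p\<^sub>i\<^sub>+\<^sub>1 = X p\<^sub>i X\<^sup>-\<^sup>1\<close> with \<open>X = X\<^sub>1\<close> for even \<open>i\<close> and \<open>X = X\<^sub>0\<close> for odd \<open>i\<close>, and this
  \<open>X\<close> sends \<open>v\<^sub>i\<close> to \<open>v\<^sub>i\<^sub>+\<^sub>1\<close>. Hence the image of \<open>p\<^sub>i\<close> is spanned by \<open>v\<^sub>i\<close>, beginning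
  with \<open>p\<^sub>0 = E\<^sub>0\<close>, and only the linear functional \<open>\<phi>\<^sub>i\<close> with
  \<open>p\<^sub>i x = \<phi>\<^sub>i(x) v\<^sub>i\<close> has to be followed: \<open>\<phi>\<^sub>i\<^sub>+\<^sub>1 = \<phi>\<^sub>i \<circ> X\<^sup>-\<^sup>1\<close>.

  Apart from correction terms with factor \<open>m\<close>, an inverse generator moves \<open>v\<^sub>j\<close> to a
  neighbour, so that \<open>i\<close> and \<open>j\<close> change parity together; only the end vectors \<open>v\<^sub>0\<close>, for
  \<open>X\<^sub>0\<close>, and \<open>v\<^sub>2\<^sub>n\<close>, for \<open>X\<^sub>1\<close>, stay in place, and there the factor \<open>l\<^sup>-\<^sup>1\<close> makes up for
  the change of parity of \<open>i\<close> alone. This is why \<open>\<phi>\<^sub>i(v\<^sub>j)\<close> depends on \<open>i - j\<close> only through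
  its parity and its sign. The correction terms cancel in \<open>\<phi>\<^sub>i\<close> unless \<open>j = i\<close>; there they
  give \<open>\<phi>\<^sub>i\<^sub>+\<^sub>1(v\<^sub>i) = m (\<tau> - 1) + l\<^sup>-\<^sup>1\<close>, which is \<open>l\<close> by the choice of \<open>\<tau>\<close>. This is how
  the value \<open>l\<^sup>-\<^sup>1\<close> for \<open>j > i\<close> turns into the value \<open>l\<close> for \<open>j < i\<close>. The lemmas
  \<open>conj_X1_rank1\<close> and \<open>conj_X0_rank1\<close> carry out this computation, one for each parity
  of \<open>i\<close>.
\<close>

lemma lin_op_cong:
  assumes "\<And>j. j \<le> 2 * n \<Longrightarrow> f j = g j"
  shows "lin_op n f = lin_op n g"
proof -
  have "(\<Sum>j<2 * n + 1. x $ j * f j $ i) = (\<Sum>j<2 * n + 1. x $ j * g j $ i)" for x i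
    by (rule sum.cong) (use assms in auto)
  then show ?thesis by (simp only: lin_op_def)
qed

lemma lin_op_comp:
  "lin_op n f (lin_op n g x) = lin_op n (\<lambda>j. lin_op n f (g j)) x"
proof (rule eq_vecI)
  fix i assume "i < dim_vec (lin_op n (\<lambda>j. lin_op n f (g j)) x)"
  then have i: "i < 2 * n + 1" by (simp add: lin_op_def)
  have "lin_op n f (lin_op n g x) $ i
      = (\<Sum>k<2 * n + 1. \<Sum>j<2 * n + 1. x $ j * (g j $ k * f k $ i))"
    using i by (simp add: lin_op_def sum_distrib_right mult.assoc del: sum.lessThan_Suc)
  also have "\<dots> = (\<Sum>j<2 * n + 1. x $ j * (\<Sum>k<2 * n + 1. g j $ k * f k $ i))"
    by (subst sum.swap) (simp only: sum_distrib_left)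
  also have "\<dots> = lin_op n (\<lambda>j. lin_op n f (g j)) x $ i"
    using i by (simp add: lin_op_def del: sum.lessThan_Suc)
  finally show "lin_op n f (lin_op n g x) $ i = lin_op n (\<lambda>j. lin_op n f (g j)) x $ i" .
qed (simp add: lin_op_def)

lemma alt_from_snoc:
  "alt_from (Suc N) A B = alt_from N A B \<circ> (if even N then A else B)"
proof (induction N arbitrary: A B)
  case (Suc N)
  have "alt_from (Suc (Suc N)) A B = A \<circ> alt_from (Suc N) B A" by simp
  also have "\<dots> = A \<circ> alt_from N B A \<circ> (if even N then B else A)"
    by (simp only: Suc.IH comp_assoc)
  finally show ?case by simp
qed simp

lemma alt_to_cons:
  "alt_to (Suc N) A B = (if even N then B else A) \<circ> alt_to N A B"
proof (induction N arbitrary: A B)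
  case (Suc N)
  have "alt_to (Suc (Suc N)) A B = alt_to (Suc N) B A \<circ> B" by simp
  also have "\<dots> = (if even N then A else B) \<circ> (alt_to N B A \<circ> B)"
    by (simp only: Suc.IH comp_assoc)
  finally show ?case by simp
qed simp

lemma var_m_tau: "var_m * tau = var_l - inverse var_l + var_m"
  by (simp add: tau_def field_simps)

text \<open>The claimed value of \<open>\<phi>\<^sub>i(v\<^sub>j)\<close>.\<close>

definition coupling :: "nat \<Rightarrow> nat \<Rightarrow> ratfun" where
  "coupling i j = (if i = j then tau else if even (i + j) then 1
     else if j < i then var_l else inverse var_l)"

definition rank1 :: "nat \<Rightarrow> nat \<Rightarrow> operator" where
  "rank1 n i = lin_op n (\<lambda>j. coupling i j \<cdot>\<^sub>v bv n i)"

lemma E0_eq_rank1: "E0 n = rank1 n 0"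
  unfolding E0_def rank1_def by (rule lin_op_cong) (auto simp: coupling_def)

lemma rank1_bv: "j \<le> 2 * n \<Longrightarrow> rank1 n i (bv n j) = coupling i j \<cdot>\<^sub>v bv n i"
  by (simp add: rank1_def lin_op_bv)

lemma rank1_smult_bv:
  "j \<le> 2 * n \<Longrightarrow> rank1 n i (c \<cdot>\<^sub>v bv n j) = (c * coupling i j) \<cdot>\<^sub>v bv n i"
  by (simp add: rank1_def lin_op_smult lin_op_bv smult_smult_assoc)

lemma rank1_add:
  "x \<in> carrier_vec (2 * n + 1) \<Longrightarrow> y \<in> carrier_vec (2 * n + 1) \<Longrightarrow>
    rank1 n i (x + y) = rank1 n i x + rank1 n i y"
  by (simp add: rank1_def lin_op_add)

lemma rank1_diff:
  "x \<in> carrier_vec (2 * n + 1) \<Longrightarrow> y \<in> carrier_vec (2 * n + 1) \<Longrightarrow>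
    rank1 n i (x - y) = rank1 n i x - rank1 n i y"
  by (simp add: rank1_def lin_op_diff)

lemma smult_bv_distrib:
  "a \<cdot>\<^sub>v bv n i + b \<cdot>\<^sub>v bv n i = (a + b) \<cdot>\<^sub>v bv n i"
  "a \<cdot>\<^sub>v bv n i - b \<cdot>\<^sub>v bv n i = (a - b) \<cdot>\<^sub>v bv n i"
  by (auto simp: algebra_simps bv_def)

lemmas rank1_simps = rank1_add rank1_diff rank1_bv rank1_smult_bv smult_bv_distrib

text \<open>The terms \<open>m v\<^sub>j - m v\<^sub>2\<^sub>n\<close> of \<open>X\<^sub>1\<^sup>-\<^sup>1 v\<^sub>j\<close>, for even \<open>j < 2n\<close>, cancel under \<open>\<phi>\<^sub>i\<close> unless
  \<open>j = i\<close>: for even \<open>i < 2n\<close> the functional \<open>\<phi>\<^sub>i\<close> is 1 at every even index but \<open>i\<close>.\<close>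

lemma conj_X1_rank1:
  assumes i: "even i" "i < 2 * n"
  shows "X1 n (rank1 n i (X1_inv n x)) = rank1 n (Suc i) x"
proof -
  let ?g = "\<lambda>j. if j = 2 * n then inverse var_l \<cdot>\<^sub>v bv n (2 * n)
     else if even j then var_m \<cdot>\<^sub>v bv n j + bv n (j + 1) - var_m \<cdot>\<^sub>v bv n (2 * n)
     else bv n (j - 1)"
  have X1_bv: "X1 n (bv n i) = bv n (Suc i)"
    using i by (simp add: X1_def lin_op_bv)
  have "rank1 n i (?g j) = coupling (Suc i) j \<cdot>\<^sub>v bv n i" if "j \<le> 2 * n" for j
  proof -
    consider "j = 2 * n" | "even j" "j < 2 * n" | "odd j" "j < 2 * n"
      using \<open>j \<le> 2 * n\<close> by fastforce
    then show ?thesis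
    proof cases
      case 1
      moreover have "Suc i \<noteq> 2 * n" using i by (metis even_Suc dvd_triv_left)
      ultimately show ?thesis using i by (auto simp: rank1_simps coupling_def)
    next
      case 2
      then have "rank1 n i (?g j)
          = (var_m * coupling i j + coupling i (Suc j) - var_m * coupling i (2 * n)) \<cdot>\<^sub>v bv n i"
        by (simp add: rank1_simps)
      also have "var_m * coupling i j + coupling i (Suc j) - var_m * coupling i (2 * n)
          = coupling (Suc i) j"
        using i 2 by (auto simp: coupling_def var_m_tau)
      finally show ?thesis .
    next
      case 3
      then show ?thesis using i by (auto simp: rank1_simps coupling_def elim: oddE)
    qed
  qed
  then have "X1 n (rank1 n i (?g j)) = coupling (Suc i) j \<cdot>\<^sub>v bv n (Suc i)" if "j \<le> 2 * n" for j
    using that X1_bv by (simp add: X1_def lin_op_smult)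
  then have "lin_op n (\<lambda>j. X1 n (rank1 n i (?g j))) = rank1 n (Suc i)"
    unfolding rank1_def[of n "Suc i"] by (rule lin_op_cong)
  then have "lin_op n (\<lambda>j. X1 n (rank1 n i (?g j))) x = rank1 n (Suc i) x"
    by (rule fun_cong)
  then show ?thesis
    by (simp only: X1_def X1_inv_def rank1_def lin_op_comp)
qed

text \<open>Here the terms with factor \<open>m\<close> are \<open>m v\<^sub>j - m l\<^sup>-\<^sup>1 v\<^sub>0\<close> for odd \<open>j\<close>. They cancel under
  \<open>\<phi>\<^sub>i\<close> unless \<open>j = i\<close>, since \<open>\<phi>\<^sub>i(v\<^sub>0) = l\<close> for odd \<open>i\<close>, and
  \<open>\<phi>\<^sub>i\<close> is 1 at every odd index but \<open>i\<close>.\<close>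

lemma conj_X0_rank1:
  assumes i: "odd i" "i < 2 * n"
  shows "X0 n (rank1 n i (X0_inv n x)) = rank1 n (Suc i) x"
proof -
  let ?g = "\<lambda>j. if j = 0 then inverse var_l \<cdot>\<^sub>v bv n 0
     else if even j then bv n (j - 1)
     else (- var_m * inverse var_l) \<cdot>\<^sub>v bv n 0 + var_m \<cdot>\<^sub>v bv n j + bv n (j + 1)"
  have X0_bv: "X0 n (bv n i) = bv n (Suc i)"
    using i by (auto simp: X0_def lin_op_bv)
  have "rank1 n i (?g j) = coupling (Suc i) j \<cdot>\<^sub>v bv n i" if "j \<le> 2 * n" for j
  proof -
    consider "j = 0" | "even j" "0 < j" | "odd j" "j < 2 * n"
      using \<open>j \<le> 2 * n\<close> by fastforce
    then show ?thesis
    proof cases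
      case 1
      then show ?thesis using i by (auto simp: rank1_simps coupling_def odd_pos)
    next
      case 2
      then show ?thesis using i that by (auto simp: rank1_simps coupling_def)
    next
      case 3
      then have "rank1 n i (?g j)
          = (- var_m * inverse var_l * coupling i 0 + var_m * coupling i j + coupling i (Suc j))
              \<cdot>\<^sub>v bv n i"
        by (auto simp: rank1_simps)
      also have "- var_m * inverse var_l * coupling i 0 + var_m * coupling i j
          + coupling i (Suc j) = coupling (Suc i) j"
        using i 3 by (auto simp: coupling_def var_m_tau odd_pos)
      finally show ?thesis .
    qed
  qed
  then have "X0 n (rank1 n i (?g j)) = coupling (Suc i) j \<cdot>\<^sub>v bv n (Suc i)" if "j \<le> 2 * n" for j
    using that X0_bv by (simp add: X0_def lin_op_smult)
  then have "lin_op n (\<lambda>j. X0 n (rank1 n i (?g j))) = rank1 n (Suc i)"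
    unfolding rank1_def[of n "Suc i"] by (rule lin_op_cong)
  then have "lin_op n (\<lambda>j. X0 n (rank1 n i (?g j))) x = rank1 n (Suc i) x"
    by (rule fun_cong)
  then show ?thesis
    by (simp only: X0_def X0_inv_def rank1_def lin_op_comp)
qed

text \<open>The new letters surround \<open>p\<^sub>i\<close>: at the front of the word that ends
  in \<open>X\<^sub>0X\<^sub>1\<close>, and at the back of the word that begins with \<open>X\<^sub>1\<^sup>-\<^sup>1X\<^sub>0\<^sup>-\<^sup>1\<close>.\<close>

lemma p_op_Suc:
  "p_op n (Suc i) = (if even i then X1 n \<circ> p_op n i \<circ> X1_inv n else X0 n \<circ> p_op n i \<circ> X0_inv n)"
  by (simp only: p_op_def alt_to_cons alt_from_snoc comp_assoc if_cancel split: if_split) simp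

lemma p_op_eq_rank1:
  assumes "i \<le> 2 * n"
  shows "p_op n i = rank1 n i"
  using assms
proof (induction i)
  case 0
  then show ?case by (simp add: p_op_def E0_eq_rank1)
next
  case (Suc i)
  then have "p_op n i = rank1 n i" by simp
  with Suc.prems show ?case
    by (auto simp: p_op_Suc fun_eq_iff conj_X1_rank1 conj_X0_rank1)
qed

theorem theorem3p2:
  fixes n i j :: nat
  assumes "n \<ge> 1" and "i \<le> 2 * n" and "j \<le> 2 * n"
  shows "p_op n i (bv n j) =
    (if i = j then tau \<cdot>\<^sub>v bv n i
     else if [int i - int j = 0] (mod 2) then bv n i
     else if i > j then var_l \<cdot>\<^sub>v bv n i
     else inverse var_l \<cdot>\<^sub>v bv n i)"
proof -
  have parity: "[int i - int j = 0] (mod 2) \<longleftrightarrow> even (i + j)"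
    by (simp add: cong_0_iff)
  have "p_op n i (bv n j) = coupling i j \<cdot>\<^sub>v bv n i"
    using assms by (simp add: p_op_eq_rank1 rank1_bv)
  then show ?thesis
    by (simp add: parity coupling_def)
qed

end
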